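(* Let $(\mathfrak g,\pi)$ be a pre-Lie algebra with product $x\cdot_{\mathfrak g}y=\pi(x,y)$, and define $\delta:C^n(\mathfrak g,\mathfrak g)\to C^{n+1}(\mathfrak g,\mathfrak g)$ by $\delta(\phi)=(-1)^n[\pi,\phi]^C$ for $\phi\in C^n(\mathfrak g,\mathfrak g)$. Then for all $n\ge1$, $\phi\in C^{n-1}(\mathfrak g,\mathfrak g)$ and $x_1,\ldots,x_{n+1}\in\mathfrak g$, \begin{align*} \delta\phi(x_1,\cdots,x_{n+1})={}&\sum_{i=1}^{n}(-1)^{i+1}\pi(x_i,\phi(x_1,\cdots,\hat{x_i},\cdots,x_{n+1}))\\ &+\sum_{i=1}^{n}(-1)^{i+1}\pi(\phi(x_1,\cdots,\hat{x_i},\cdots,x_n,x_i),x_{n+1})\\ &-\sum_{i=1}^{n}(-1)^{i+1}\phi(x_1,\cdots,\hat{x_i},\cdots,x_n,\pi(x_i,x_{n+1}))\\ &+\sum_{1\le i<j\le n}(-1)^{i+j}\phi(\pi(x_i,x_j)-\pi(x_j,x_i),x_1,\cdots,\hat{x_i},\cdots,\hat{x_j},\cdots,x_{n+1}). \end{align*} Thus $\delta=\mathrm d^{\rm reg}$, the coboundary operator of the pre-Lie algebra with coefficients in the regular representation $(\mathfrak g;L,R)$.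
   Context: $\mathbb K$ is an algebraically closed field of characteristic $0$; vector spaces are finite dimensional over $\mathbb K$. A pre-Lie algebra is a vector space $\mathfrak g$ with a bilinear product $\cdot_{\mathfrak g}$ such that $(x\cdot_{\mathfrak g} y)\cdot_{\mathfrak g} z-x\cdot_{\mathfrak g}(y\cdot_{\mathfrak g} z)$ is symmetric in $x,y$. Its commutator is $[x,y]^c=x\cdot_{\mathfrak g}y-y\cdot_{\mathfrak g}x$ (a Lie bracket). $L_xy=x\cdot_{\mathfrak g}y$, $R_xy=y\cdot_{\mathfrak g}x$. Let $A^p(\mathfrak g,\mathfrak g)=\mathrm{Hom}(\otimes^{p+1}\mathfrak g,\mathfrak g)$. For $P\in A^p$, $Q\in A^q$: $P\circ Q(x_1,\ldots,x_{p+q+1})=\sum_{i=1}^{p+1}(-1)^{(i-1)q}P(x_1,\ldots,x_{i-1},Q(x_i,\ldots,x_{i+q}),x_{i+q+1},\ldots,x_{p+q+1})$ and $[P,Q]^G=P\circ Q-(-1)^{pq}Q\circ P$. The alternator is $\alpha(P)(x_1,\ldots,x_{p+1})=\frac1{p!}\sum_{\sigma\in S_p}\mathrm{sgn}(\sigma)P(x_{\sigma(1)},\ldots,x_{\sigma(p)},x_{p+1})$ for $P\in A^p$. Let $C^p(\mathfrak g,\mathfrak g)=\mathrm{Hom}(\wedge^p\mathfrak g\otimes\mathfrak g,\mathfrak g)=\alpha(A^p(\mathfrak g,\mathfrak g))$, and for $P\in C^p$, $Q\in C^q$: $[P,Q]^C=\frac{(p+q)!}{p!q!}\alpha([P,Q]^G)$.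 A representation of $(\mathfrak g,\cdot_{\mathfrak g})$ on $V$ is a pair $\rho,\mu:\mathfrak g\to\mathfrak{gl}(V)$ with $\rho$ a representation of the Lie algebra $(\mathfrak g,[\cdot,\cdot]^c)$ and $\rho(x)\mu(y)-\mu(y)\rho(x)=\mu(x\cdot_{\mathfrak g}y)-\mu(y)\mu(x)$; the regular representation is $(\mathfrak g;L,R)$. The coboundary operator $\mathrm d:\mathrm{Hom}(\wedge^{n-1}\mathfrak g\otimes\mathfrak g,V)\to\mathrm{Hom}(\wedge^n\mathfrak g\otimes\mathfrak g,V)$ is \begin{align*}\mathrm d\phi(x_1,\cdots,x_{n+1})={}&\sum_{i=1}^{n}(-1)^{i+1}\rho(x_i)\phi(x_1,\cdots,\hat{x_i},\cdots,x_{n+1})+\sum_{i=1}^{n}(-1)^{i+1}\mu(x_{n+1})\phi(x_1,\cdots,\hat{x_i},\cdots,x_n,x_i)\\&-\sum_{i=1}^{n}(-1)^{i+1}\phi(x_1,\cdots,\hat{x_i},\cdots,x_n,x_i\cdot_{\mathfrak g}x_{n+1})+\sum_{1\le i<j\le n}(-1)^{i+j}\phi([x_i,x_j]^c,x_1,\cdots,\hat{x_i},\cdots,\hat{x_j},\cdots,x_{n+1}),\end{align*} and $\mathrm d^{\rm reg}$ denotes $\mathrm d$ for the regular representation. *)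

theory Defs
  imports "HOL-Combinatorics.Permutations" "HOL-Computational_Algebra.Polynomial"
begin

section \<open>Pre-Lie algebras and their representations\<close>

locale pre_lie_algebra = finite_dimensional_vector_space scale Basis
  for scale :: "'k::field \<Rightarrow> 'g::ab_group_add \<Rightarrow> 'g" (infixr \<open>*s\<close> 75)
    and Basis :: "'g set" +
  fixes mul :: "'g \<Rightarrow> 'g \<Rightarrow> 'g" (infixl \<open>\<cdot>\<close> 70)
  assumes linear_left: "Vector_Spaces.linear (*s) (*s) (\<lambda>x. x \<cdot> y)"
    and linear_right: "Vector_Spaces.linear (*s) (*s) (\<lambda>y. x \<cdot> y)"
    and associator_sym: "(x \<cdot> y) \<cdot> z - x \<cdot> (y \<cdot> z) = (y \<cdot> x) \<cdot> z - y \<cdot> (x \<cdot> z)"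

definition commutator :: "('g \<Rightarrow> 'g \<Rightarrow> 'g::ab_group_add) \<Rightarrow> 'g \<Rightarrow> 'g \<Rightarrow> 'g" where
  "commutator mul x y = mul x y - mul y x"

locale pre_lie_rep = pre_lie_algebra scale Basis mul +
    V: finite_dimensional_vector_space scaleV BasisV
  for scale :: "'k::field \<Rightarrow> 'g::ab_group_add \<Rightarrow> 'g" (infixr \<open>*s\<close> 75)
    and Basis :: "'g set"
    and mul :: "'g \<Rightarrow> 'g \<Rightarrow> 'g" (infixl \<open>\<cdot>\<close> 70)
    and scaleV :: "'k \<Rightarrow> 'v::ab_group_add \<Rightarrow> 'v" (infixr \<open>*v\<close> 75)
    and BasisV :: "'v set" +
  fixes \<rho> \<mu> :: "'g \<Rightarrow> 'v \<Rightarrow> 'v"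
  assumes rho_linear: "Vector_Spaces.linear (*s) (*v) (\<lambda>x. \<rho> x v)"
    and rho_endo: "Vector_Spaces.linear (*v) (*v) (\<rho> x)"
    and mu_linear: "Vector_Spaces.linear (*s) (*v) (\<lambda>x. \<mu> x v)"
    and mu_endo: "Vector_Spaces.linear (*v) (*v) (\<mu> x)"
    and rho_commutator: "\<rho> (commutator (\<cdot>) x y) v = \<rho> x (\<rho> y v) - \<rho> y (\<rho> x v)"
    and rho_mu: "\<rho> x (\<mu> y v) - \<mu> y (\<rho> x v) = \<mu> (x \<cdot> y) v - \<mu> y (\<mu> x v)"

lemma (in pre_lie_algebra) regular_representation:
  "pre_lie_rep (*s) Basis (\<cdot>) (*s) Basis (\<lambda>x y. x \<cdot> y) (\<lambda>x y. y \<cdot> x)"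
proof unfold_locales
  fix x y v
  interpret l: Vector_Spaces.linear "(*s)" "(*s)" "\<lambda>x. x \<cdot> v" by (rule linear_left)
  show "commutator (\<cdot>) x y \<cdot> v = x \<cdot> (y \<cdot> v) - y \<cdot> (x \<cdot> v)"
    using associator_sym[of x y v] by (simp add: commutator_def l.diff algebra_simps)
  show "x \<cdot> (v \<cdot> y) - (x \<cdot> v) \<cdot> y = v \<cdot> (x \<cdot> y) - (v \<cdot> x) \<cdot> y"
    using associator_sym[of x v y] by (simp add: algebra_simps)
qed (use linear_left linear_right in 
    \<open>auto simp: Vector_Spaces.linear_iff_module_hom module_hom_iff\<close>)


section \<open>Cochains\<close>

text \<open>
  A linear map on the \<open>m\<close>-th tensor power is represented by a function on lists of length \<open>m\<close>
  that is linear in each entry. It takes the value 0 on lists of any other length, so that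
  equality of functions is equality of cochains. List positions start at 0: the argument
  \<open>x\<^sub>i\<close> of the usual notation is \<open>xs ! (i - 1)\<close>, and a sign \<open>(-1)\<close> to the \<open>i + 1\<close> becomes
  \<open>(-1)\<close> to the \<open>i\<close> after the shift, while \<open>(-1)\<close> to the \<open>i + j\<close> is unaffected.
  The degrees of cochains are explicit arguments of the operations below.
\<close>

definition multilinear_maps ::
    "('k::field \<Rightarrow> 'g::ab_group_add \<Rightarrow> 'g) \<Rightarrow> ('k \<Rightarrow> 'v::ab_group_add \<Rightarrow> 'v) \<Rightarrow> nat
      \<Rightarrow> ('g list \<Rightarrow> 'v) set" where
  "multilinear_maps scale scaleV m = {P.
     (\<forall>xs. length xs \<noteq> m \<longrightarrow> P xs = 0) \<and>
     (\<forall>xs i. length xs = m \<longrightarrow> i < m \<longrightarrow>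
        Vector_Spaces.linear scale scaleV (\<lambda>v. P (xs[i := v])))}"

text \<open>\<open>A\<^sup>p(\<gg>,\<gg>)\<close>, with \<open>p + 1\<close> arguments.\<close>

definition A_space :: "('k::field \<Rightarrow> 'g::ab_group_add \<Rightarrow> 'g) \<Rightarrow> nat \<Rightarrow> ('g list \<Rightarrow> 'g) set" where
  "A_space scale p = multilinear_maps scale scale (p + 1)"

text \<open>\<open>Hom(\<and>\<^sup>p\<gg> \<otimes> \<gg>, V)\<close>: alternating in the first \<open>p\<close> of the \<open>p + 1\<close> arguments.\<close>

definition wedge_hom ::
    "('k::field \<Rightarrow> 'g::ab_group_add \<Rightarrow> 'g) \<Rightarrow> ('k \<Rightarrow> 'v::ab_group_add \<Rightarrow> 'v) \<Rightarrow> nat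
      \<Rightarrow> ('g list \<Rightarrow> 'v) set" where
  "wedge_hom scale scaleV p = {P \<in> multilinear_maps scale scaleV (p + 1).
     \<forall>xs i j. length xs = p + 1 \<longrightarrow> i < j \<longrightarrow> j < p \<longrightarrow> xs ! i = xs ! j \<longrightarrow> P xs = 0}"

definition C_space :: "('k::field \<Rightarrow> 'g::ab_group_add \<Rightarrow> 'g) \<Rightarrow> nat \<Rightarrow> ('g list \<Rightarrow> 'g) set" where
  "C_space scale p = wedge_hom scale scale p"

definition product_cochain :: "('g \<Rightarrow> 'g \<Rightarrow> 'g) \<Rightarrow> 'g list \<Rightarrow> 'g::ab_group_add" where
  "product_cochain mul xs = (if length xs = 2 then mul (xs ! 0) (xs ! 1) else 0)"

definition circ ::
    "('k::field \<Rightarrow> 'g::ab_group_add \<Rightarrow> 'g) \<Rightarrow> nat \<Rightarrow> nat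
      \<Rightarrow> ('g list \<Rightarrow> 'g) \<Rightarrow> ('g list \<Rightarrow> 'g) \<Rightarrow> 'g list \<Rightarrow> 'g" where
  "circ scale p q P Q xs = (if length xs = p + q + 1 then
     (\<Sum>i<p+1. scale ((- 1) ^ (i * q))
        (P (take i xs @ [Q (take (q + 1) (drop i xs))] @ drop (i + q + 1) xs)))
     else 0)"

definition G_bracket ::
    "('k::field \<Rightarrow> 'g::ab_group_add \<Rightarrow> 'g) \<Rightarrow> nat \<Rightarrow> nat
      \<Rightarrow> ('g list \<Rightarrow> 'g) \<Rightarrow> ('g list \<Rightarrow> 'g) \<Rightarrow> 'g list \<Rightarrow> 'g" where
  "G_bracket scale p q P Q xs =
     circ scale p q P Q xs - scale ((- 1) ^ (p * q)) (circ scale q p Q P xs)"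

text \<open>
  A permutation of \<open>{..<p}\<close> fixes \<open>p\<close>, so \<^const>\<open>permute_list\<close> leaves the last entry of a list
  of length \<open>p + 1\<close> in place.
\<close>

definition alternator ::
    "('k::field_char_0 \<Rightarrow> 'g::ab_group_add \<Rightarrow> 'g) \<Rightarrow> nat \<Rightarrow> ('g list \<Rightarrow> 'g) \<Rightarrow> 'g list \<Rightarrow> 'g" where
  "alternator scale p P xs = (if length xs = p + 1 then
     scale (1 / fact p)
       (\<Sum>\<sigma> | \<sigma> permutes {..<p}. scale (of_int (sign \<sigma>)) (P (permute_list \<sigma> xs)))
     else 0)"

context vector_space
begin

lemma multilinear_maps_iff:
  "P \<in> multilinear_maps scale scale m \<longleftrightarrow>
    (\<forall>xs. length xs \<noteq> m \<longrightarrow> P xs = 0) \<and>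
    (\<forall>xs i a b. length xs = m \<longrightarrow> i < m \<longrightarrow> P (xs[i := a + b]) = P (xs[i := a]) + P (xs[i := b])) \<and>
    (\<forall>xs i c a. length xs = m \<longrightarrow> i < m \<longrightarrow> P (xs[i := scale c a]) = scale c (P (xs[i := a])))"
  unfolding multilinear_maps_def Vector_Spaces.linear_iff_module_hom module_hom_iff using module_axioms by auto

lemma permute_list_update:
  assumes "\<sigma> permutes {..<length xs}" "i < length xs"
  shows "permute_list \<sigma> (xs[i := v]) = (permute_list \<sigma> xs)[inv \<sigma> i := v]"
proof (rule nth_equalityI)
  fix k assume "k < length (permute_list \<sigma> (xs[i := v]))"
  then have k: "k < length xs" by simp
  have "inv \<sigma> i = k \<longleftrightarrow> \<sigma> k = i"
    using assms(1) by (metis permutes_inverses(1,2))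
  moreover have "\<sigma> k < length xs"
    using permutes_in_image[OF assms(1)] k by auto
  ultimately show "permute_list \<sigma> (xs[i := v]) ! k = (permute_list \<sigma> xs)[inv \<sigma> i := v] ! k"
    using k assms by (auto simp: permute_list_nth nth_list_update)
qed simp

end

lemma alternating_transpose:
  fixes scale :: "'k::field_char_0 \<Rightarrow> 'g::ab_group_add \<Rightarrow> 'g"
  assumes "vector_space scale" and P: "P \<in> C_space scale p"
    and xs: "length xs = p + 1" and ij: "i < p" "j < p" "i \<noteq> j"
  shows "P (permute_list (transpose i j) xs) = - P xs"
proof -
  interpret vector_space scale by fact
  have m: "P \<in> multilinear_maps scale scale (p + 1)"
    and alt: "\<And>xs i j. length xs = p + 1 \<Longrightarrow> i < j \<Longrightarrow> j < p \<Longrightarrow> xs ! i = xs ! j \<Longrightarrow> P xs = 0"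
    using P by (auto simp: C_space_def wedge_hom_def)
  have add: "P (ys[k := a + b]) = P (ys[k := a]) + P (ys[k := b])"
    if "length ys = p + 1" "k < p" for ys k a b
    using m that by (simp add: multilinear_maps_iff)
  define F where "F a b = P (xs[i := a, j := b])" for a b
  have F0: "F a a = 0" for a
    unfolding F_def using xs ij alt[of "xs[i := a, j := a]" i j] alt[of "xs[i := a, j := a]" j i]
    by (cases "i < j") (auto simp: nth_list_update)
  have F1: "F a (b + c) = F a b + F a c" for a b c
    unfolding F_def using add xs ij by simp
  have F2: "F (b + c) a = F b a + F c a" for a b c
    unfolding F_def using add[of "xs[j := a]" i b c] xs ij by (simp add: list_update_swap)
  have "F (xs ! j) (xs ! i) = - F (xs ! i) (xs ! j)"
  proof -
    let ?a = "xs ! i" and ?b = "xs ! j"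
    have "F (?a + ?b) (?a + ?b) = F ?b ?a + F ?a ?b"
      unfolding F1 F2 by (simp add: F0)
    then have "F ?b ?a + F ?a ?b = 0" by (simp only: F0)
    then show ?thesis by (simp only: eq_neg_iff_add_eq_0)
  qed
  moreover have "xs[i := xs ! j, j := xs ! i] = permute_list (transpose i j) xs"
    using xs ij by (intro nth_equalityI)
      (auto simp: nth_list_update permute_list_def transpose_def simp del: upt_Suc)
  ultimately show ?thesis
    by (simp add: F_def)
qed

lemma alternating_permute:
  fixes scale :: "'k::field_char_0 \<Rightarrow> 'g::ab_group_add \<Rightarrow> 'g"
  assumes vs: "vector_space scale" and P: "P \<in> C_space scale p"
    and "\<sigma> permutes {..<p}" and "length xs = p + 1"
  shows "P (permute_list \<sigma> xs) = scale (of_int (sign \<sigma>)) (P xs)"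
proof -
  interpret vector_space scale by fact
  have "finite {..<p}" by simp
  then show ?thesis using assms(3,4)
  proof (induction arbitrary: xs rule: permutes_rev_induct)
    case id
    then show ?case by simp
  next
    case (swap a b q)
    show ?case
    proof -
      have q: "permutation q" using swap by (auto simp: permutation_permutes)
      have t: "transpose a b permutes {..<length xs}"
        using swap by (intro permutes_swap_id) auto
      have "P (permute_list (q \<circ> transpose a b) xs) = - P (permute_list q xs)"
        unfolding permute_list_compose[OF t]
        using swap.hyps swap.prems by (intro alternating_transpose[OF vs P]) auto
      moreover have "sign (q \<circ> transpose a b) = - sign q"
        using swap.hyps by (simp add: sign_compose[OF q permutation_swap_id] sign_swap_id)
      ultimately show ?thesis
        using swap.IH[OF swap.prems] by (simp only: of_int_minus scale_minus_left)
    qed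
  qed
qed

lemma alternator_image:
  fixes scale :: "'k::field_char_0 \<Rightarrow> 'g::ab_group_add \<Rightarrow> 'g"
  assumes vs: "vector_space scale"
  shows "C_space scale p = alternator scale p ` A_space scale p"
proof -
  interpret vector_space scale by fact
  have "alternator scale p P = P" if P: "P \<in> C_space scale p" for P
  proof
    fix xs
    show "alternator scale p P xs = P xs"
    proof (cases "length xs = p + 1")
      case True
      have "(\<Sum>\<sigma> | \<sigma> permutes {..<p}. scale (of_int (sign \<sigma>)) (P (permute_list \<sigma> xs)))
          = (\<Sum>\<sigma> | \<sigma> permutes {..<p}. P xs)"
        by (intro sum.cong refl)
          (simp add: alternating_permute[OF vs P _ True] flip: of_int_mult)
      also have "\<dots> = scale (fact p) (P xs)"
        by (simp add: sum_constant_scale card_permutations)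
      finally show ?thesis using True by (simp add: alternator_def)
    next
      case False
      then show ?thesis
        using P by (simp add: alternator_def C_space_def wedge_hom_def multilinear_maps_def)
    qed
  qed
  moreover have "alternator scale p P \<in> C_space scale p" if P: "P \<in> A_space scale p" for P
  proof -
    let ?S = "\<lambda>xs. \<Sum>\<sigma> | \<sigma> permutes {..<p}. scale (of_int (sign \<sigma>)) (P (permute_list \<sigma> xs))"
    have upd: "permute_list \<sigma> (xs[i := v]) = (permute_list \<sigma> xs)[inv \<sigma> i := v]
        \<and> inv \<sigma> i < p + 1"
      if "\<sigma> permutes {..<p}" "length xs = p + 1" "i < p + 1" for \<sigma> i v and xs :: "'g list"
    proof -
      have s: "\<sigma> permutes {..<length xs}"
        using that by (intro permutes_subset[OF that(1)]) auto
      then show ?thesis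
        using that permute_list_update[OF s] permutes_in_image[OF permutes_inv[OF s], of i] by auto
    qed
    have mP: "P (ys[k := a + b]) = P (ys[k := a]) + P (ys[k := b])"
        "P (ys[k := scale c a]) = scale c (P (ys[k := a]))"
      if "length ys = p + 1" "k < p + 1" for ys k a b c
      using P that by (simp_all add: A_space_def multilinear_maps_iff)
    have add: "?S (xs[i := a + b]) = ?S (xs[i := a]) + ?S (xs[i := b])"
      if "length xs = p + 1" "i < p + 1" for xs i a b
      unfolding sum.distrib[symmetric] scale_right_distrib[symmetric]
      using that upd by (intro sum.cong refl) (simp add: mP)
    have hom: "?S (xs[i := scale c a]) = scale c (?S (xs[i := a]))"
      if "length xs = p + 1" "i < p + 1" for xs i a c
      unfolding scale_sum_right
      using that upd by (intro sum.cong refl) (simp add: mP scale_left_commute)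
    have "alternator scale p P \<in> multilinear_maps scale scale (p + 1)"
      unfolding multilinear_maps_iff alternator_def
      by (simp add: add[simplified] hom[simplified] scale_right_distrib
          scale_left_commute[of "1 / fact p"])
    moreover have "?S xs = 0"
      if xs: "length xs = p + 1" and ij: "i < j" "j < p" "xs ! i = xs ! j" for xs i j
    proof -
      let ?t = "transpose i j"
      have t: "?t permutes {..<p}" using ij by (intro permutes_swap_id) auto
      have tx: "permute_list ?t xs = xs"
        using xs ij by (intro nth_equalityI) 
          (auto simp: permute_list_def transpose_def simp del: upt_Suc)
      have "?S xs = (\<Sum>\<sigma> | \<sigma> permutes {..<p}.
          scale (of_int (sign (?t \<circ> \<sigma>))) (P (permute_list (?t \<circ> \<sigma>) xs)))"
        by (rule setum_permutations_compose_left[OF t])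
      also have "\<dots> = (\<Sum>\<sigma> | \<sigma> permutes {..<p}.
          - scale (of_int (sign \<sigma>)) (P (permute_list \<sigma> xs)))"
      proof (intro sum.cong refl)
        fix \<sigma> assume "\<sigma> \<in> {\<sigma>. \<sigma> permutes {..<p}}"
        then have s: "\<sigma> permutes {..<p}" by simp
        then have "permutation \<sigma>" by (auto simp: permutation_permutes)
        moreover have "\<sigma> permutes {..<length xs}"
          using xs by (intro permutes_subset[OF s]) auto
        ultimately show "scale (of_int (sign (?t \<circ> \<sigma>))) (P (permute_list (?t \<circ> \<sigma>) xs))
            = - scale (of_int (sign \<sigma>)) (P (permute_list \<sigma> xs))"
          using ij by (simp add: permute_list_compose tx sign_compose sign_swap_id
              permutation_swap_id)
      qed
      finally have e: "?S xs = - ?S xs" by (simp add: sum_negf)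
      have "x = 0" if "x = - x" for x :: 'g
      proof -
        have "scale 2 x = scale 1 x + scale 1 x"
          unfolding scale_left_distrib[symmetric] by simp
        also have "\<dots> = x + - x"
          using arg_cong[OF that, of "(+) x"] by (simp only: scale_one)
        finally have "scale 2 x = 0"
          by (simp only: add.right_inverse)
        then show ?thesis by simp
      qed
      from this[OF e] show ?thesis .
    qed
    ultimately show ?thesis
      by (auto simp: C_space_def wedge_hom_def alternator_def)
  qed
  moreover have "C_space scale p \<subseteq> A_space scale p"
    by (auto simp: C_space_def wedge_hom_def A_space_def)
  ultimately show ?thesis by (metis (no_types, lifting) image_subset_iff image_eqI subset_antisym subsetD subsetI)
qed

definition C_bracket ::
    "('k::field_char_0 \<Rightarrow> 'g::ab_group_add \<Rightarrow> 'g) \<Rightarrow> nat \<Rightarrow> nat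
      \<Rightarrow> ('g list \<Rightarrow> 'g) \<Rightarrow> ('g list \<Rightarrow> 'g) \<Rightarrow> 'g list \<Rightarrow> 'g" where
  "C_bracket scale p q P Q xs =
     scale (fact (p + q) / (fact p * fact q))
       (alternator scale (p + q) (G_bracket scale p q P Q) xs)"

definition delta ::
    "('k::field_char_0 \<Rightarrow> 'g::ab_group_add \<Rightarrow> 'g) \<Rightarrow> ('g \<Rightarrow> 'g \<Rightarrow> 'g) \<Rightarrow> nat
      \<Rightarrow> ('g list \<Rightarrow> 'g) \<Rightarrow> 'g list \<Rightarrow> 'g" where
  "delta scale mul n \<phi> xs =
     scale ((- 1) ^ n) (C_bracket scale 1 n (product_cochain mul) \<phi> xs)"

text \<open>
  The coboundary operator \<open>Hom(\<and>\<^sup>n\<^sup>-\<^sup>1\<gg> \<otimes> \<gg>, V) \<rightarrow> Hom(\<and>\<^sup>n\<gg> \<otimes> \<gg>, V)\<close>. Arguments with a hat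
  are removed by \<^const>\<open>nths\<close>; \<open>butlast xs\<close> is \<open>x\<^sub>1, \<dots>, x\<^sub>n\<close> and \<open>xs ! n\<close> is the last argument.
\<close>

definition coboundary ::
    "('k::field \<Rightarrow> 'v::ab_group_add \<Rightarrow> 'v) \<Rightarrow> ('g::ab_group_add \<Rightarrow> 'g \<Rightarrow> 'g)
      \<Rightarrow> ('g \<Rightarrow> 'v \<Rightarrow> 'v) \<Rightarrow> ('g \<Rightarrow> 'v \<Rightarrow> 'v) \<Rightarrow> nat \<Rightarrow> ('g list \<Rightarrow> 'v) \<Rightarrow> 'g list \<Rightarrow> 'v" where
  "coboundary scaleV mul \<rho> \<mu> n \<phi> xs = (if length xs = n + 1 then
       (\<Sum>i<n. scaleV ((- 1) ^ i) (\<rho> (xs ! i) (\<phi> (nths xs (- {i})))))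
     + (\<Sum>i<n. scaleV ((- 1) ^ i) (\<mu> (xs ! n) (\<phi> (nths (butlast xs) (- {i}) @ [xs ! i]))))
     - (\<Sum>i<n. scaleV ((- 1) ^ i)
          (\<phi> (nths (butlast xs) (- {i}) @ [mul (xs ! i) (xs ! n)])))
     + (\<Sum>j<n. \<Sum>i<j. scaleV ((- 1) ^ (i + j))
          (\<phi> (commutator mul (xs ! i) (xs ! j) # nths xs (- {i, j}))))
     else 0)"

definition coboundary_reg ::
    "('k::field \<Rightarrow> 'g::ab_group_add \<Rightarrow> 'g) \<Rightarrow> ('g \<Rightarrow> 'g \<Rightarrow> 'g) \<Rightarrow> nat
      \<Rightarrow> ('g list \<Rightarrow> 'g) \<Rightarrow> 'g list \<Rightarrow> 'g" where
  "coboundary_reg scale mul = coboundary scale mul (\<lambda>x y. mul x y) (\<lambda>x y. mul y x)"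

end

theory Submission
  imports Defs
begin

text \<open>
  Put \<open>m = n - 1\<close>. The factorials in \<open>[\<pi>, \<phi>]\<^sup>C\<close> and in the alternator combine to \<open>1 / m!\<close>, so
  \<open>\<delta>\<phi>\<close> is \<open>(- 1)\<^sup>m / m!\<close> times the signed sum, over the permutations of the first \<open>m + 1\<close>
  arguments, of \<open>\<pi> \<circ> \<phi> - (- 1)\<^sup>m \<phi> \<circ> \<pi>\<close>. The compositions consist of the summands
  \<open>\<pi>(\<phi>(\<dots>), -)\<close>, \<open>\<pi>(-, \<phi>(\<dots>))\<close> and \<open>\<phi>(\<dots>, \<pi>(-, -), \<dots>)\<close>, the last with the product at
  any of the \<open>m + 1\<close> slots. Each summand is already alternating in most of its arguments, and this
  is what cancels \<open>m!\<close>.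

  The tool is an expansion of a signed sum along one position, as for determinants: every
  permutation of \<open>{..n}\<close> is, in exactly one way, a cycle that carries some entry \<open>b\<close> to position
  \<open>n\<close> and has sign \<open>(- 1)\<close> to the \<open>n - b\<close>, composed with a permutation of \<open>{..<n}\<close>
  (\<open>signed_sum_Suc\<close>). A summand of one of the two \<open>\<pi>\<close>-outside kinds, or the \<open>\<phi>\<close>-outside summand
  with the product in the last slot, singles out one argument \<open>x\<^sub>b\<close> and is alternating in the
  remaining \<open>m\<close>; one expansion gives \<open>m!\<close> times a sum over \<open>b\<close>, which is one of the first three
  sums of the coboundary (\<open>signed_sum_expand\<close>).

  Each of the other \<open>m\<close> summands \<open>\<phi>(\<dots>, \<pi>(x\<^sub>i, x\<^sub>i\<^sub>+\<^sub>1), \<dots>)\<close> has the same signed sum up to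
  \<open>(- 1)\<^sup>i\<close>, the sign with which \<open>\<pi>(x\<^sub>i, x\<^sub>i\<^sub>+\<^sub>1)\<close> moves to the front slot of \<open>\<phi>\<close>, because carrying a
  pair of neighbours along a list is an even permutation (\<open>signed_sum_phi_mul_adjacent\<close>). This
  sign cancels the one in \<open>\<phi> \<circ> \<pi>\<close>. The common value, computed by expanding twice, is a sum over
  ordered pairs of positions with the factor \<open>(m - 1)!\<close>; the \<open>m\<close> equal summands complete it to \<open>m!\<close>,
  and the two orders of a pair form the commutator (\<open>signed_sum_phi_mul_penultimate\<close>).

  Finally, \<open>\<delta>\<phi>\<close> is a cochain because the compositions \<open>\<pi> \<circ> \<phi>\<close> and \<open>\<phi> \<circ> \<pi>\<close> are multilinear and the
  alternator maps \<open>A\<^sup>n\<close> onto \<open>C\<^sup>n\<close>.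
\<close>

section \<open>Carrying one entry of a list to a later position\<close>

text \<open>
  For \<open>b \<le> k\<close> this is the cycle \<open>b \<mapsto> b + 1 \<mapsto> \<dots> \<mapsto> k \<mapsto> b\<close>. Since \<^const>\<open>permute_list\<close> reads
  the entry at the image of a position, permuting a list by it carries the entry at \<open>b\<close> to position
  \<open>k\<close> and moves the entries in between one place down.
\<close>

definition carry :: "nat \<Rightarrow> nat \<Rightarrow> nat \<Rightarrow> nat" where
  "carry b k l = (if l < b \<or> k < l then l else if l = k then b else Suc l)"

text \<open>
  Carrying an entry one position further is one more adjacent transposition, which accounts for the
  sign.
\<close>

lemma carry_permutes_sign:
  assumes "b \<le> k"
  shows "carry b k permutes {..k} \<and> sign (carry b k) = (- 1) ^ (k - b)"
  using assms
proof (induction rule: dec_induct)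
  case base
  have "carry b b = id"
    by (auto simp: carry_def fun_eq_iff)
  then show ?case
    using permutes_id[of "{..b}"] sign_id by (simp only: diff_self_eq_0 power_0 simp_thms)
next
  case (step m)
  have eq: "carry b (Suc m) = carry b m \<circ> transpose m (Suc m)"
    using step.hyps by (auto simp: carry_def fun_eq_iff transpose_def)
  have p: "carry b m permutes {..Suc m}"
    using step.IH by (rule permutes_subset[OF conjunct1]) auto
  have t: "transpose m (Suc m) permutes {..Suc m}"
    by (rule permutes_swap_id) auto
  have "permutation (carry b m)"
    using p by (auto simp: permutation_permutes)
  then have "sign (carry b (Suc m)) = - sign (carry b m)"
    unfolding eq by (simp add: sign_compose permutation_swap_id sign_swap_id)
  moreover have "carry b (Suc m) permutes {..Suc m}"
    unfolding eq by (rule permutes_compose[OF t p])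
  ultimately show ?case
    using step by (simp add: Suc_diff_le)
qed

lemma carry_permutes:
  assumes "b \<le> k" "k < n"
  shows "carry b k permutes {..<n}"
proof -
  have "{..k} \<subseteq> {..<n}" using assms by auto
  then show ?thesis
    using permutes_subset[OF conjunct1[OF carry_permutes_sign[OF assms(1)]]] by blast
qed

lemma sign_carry: "b \<le> k \<Longrightarrow> sign (carry b k) = (- 1) ^ (k - b)"
  using carry_permutes_sign by blast

lemma nths_remove_nth:
  assumes "b < length xs"
  shows "nths xs (- {b}) = take b xs @ drop (Suc b) xs"
proof -
  have "nths xs (- {b}) = nths (take b xs @ xs ! b # drop (Suc b) xs) (- {b})"
    using assms by (simp add: id_take_nth_drop[symmetric])
  then show ?thesis
    using assms by (simp add: nths_append nths_Cons nths_all min_def)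
qed

text \<open>
  A second expansion removes an entry from a list that has already lost one. Both orders of removal
  occur there; if the smaller position goes first, then the larger one has dropped to \<open>j - 1\<close>.
\<close>

lemma nths_remove_two:
  assumes "i < j" "j < length xs"
  shows "nths xs (- {i, j}) = take i (nths xs (- {j})) @ drop (Suc i) (nths xs (- {j}))"
proof -
  have "nths xs (- {i, j}) = nths (take j xs @ xs ! j # drop (Suc j) xs) (- {i, j})"
    using assms by (simp add: id_take_nth_drop[symmetric])
  also have "\<dots> = nths (take j xs) (- {i, j}) @ drop (Suc j) xs"
    using assms by (simp add: nths_append nths_Cons nths_all min_def)
  also have "nths (take j xs) (- {i, j}) = nths (take j xs) (- {i})"
    using assms unfolding nths_def
    by (intro arg_cong[where f="map fst"] filter_cong refl) (auto simp: set_zip)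
  finally show ?thesis
    using assms by (simp add: nths_remove_nth min_def)
qed

lemma nths_remove_two':
  assumes "i < j" "j < length xs"
  shows "nths xs (- {i, j}) = take (j - 1) (nths xs (- {i})) @ drop j (nths xs (- {i}))"
proof -
  obtain d where "j = Suc (i + d)"
    using assms less_imp_Suc_add by blast
  then show ?thesis
    using assms by (simp add: nths_remove_two nths_remove_nth min_def drop_take add.commute)
qed

lemma permute_list_carry:
  assumes "b \<le> k" "k < length xs"
  shows "permute_list (carry b k) xs =
    take b xs @ drop (Suc b) (take (Suc k) xs) @ xs ! b # drop (Suc k) xs"
proof (rule nth_equalityI)
  show "length (permute_list (carry b k) xs) =
      length (take b xs @ drop (Suc b) (take (Suc k) xs) @ xs ! b # drop (Suc k) xs)"
    using assms by (auto simp: min_def)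
next
  fix l assume "l < length (permute_list (carry b k) xs)"
  then show "permute_list (carry b k) xs ! l =
      (take b xs @ drop (Suc b) (take (Suc k) xs) @ xs ! b # drop (Suc k) xs) ! l"
    using assms carry_permutes[OF assms]
    by (auto simp: permute_list_nth carry_def nth_append nth_Cons' min_def)
qed

lemma permute_list_carry_append:
  "permute_list (carry (length us) (length us + length vs)) (us @ y # vs @ ws) = us @ vs @ y # ws"
  by (simp add: permute_list_carry)

lemma permute_list_append:
  assumes "\<sigma> permutes {..<length us}"
  shows "permute_list \<sigma> (us @ vs) = permute_list \<sigma> us @ vs"
proof (rule nth_equalityI)
  fix k assume k: "k < length (permute_list \<sigma> (us @ vs))"
  have \<sigma>: "\<sigma> permutes {..<length (us @ vs)}"
    by (rule permutes_subset[OF assms]) auto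
  show "permute_list \<sigma> (us @ vs) ! k = (permute_list \<sigma> us @ vs) ! k"
  proof (cases "k < length us")
    case True
    moreover have "\<sigma> k < length us"
      using permutes_in_image[OF assms, of k] True by simp
    ultimately show ?thesis
      using k by (simp add: permute_list_nth[OF \<sigma>] permute_list_nth[OF assms] nth_append)
  next
    case False
    then have "\<sigma> k = k"
      using permutes_not_in[OF assms, of k] by simp
    then show ?thesis
      using k False by (simp add: permute_list_nth[OF \<sigma>] nth_append)
  qed
qed simp

lemma permute_list_carry_penultimate:
  assumes "length xs = Suc (Suc m)" "b \<le> m"
  shows "permute_list (carry b m) xs = nths (butlast xs) (- {b}) @ [xs ! b, xs ! Suc m]"
proof -
  have "xs \<noteq> []" "drop (Suc m) xs = [xs ! Suc m]"
    using assms(1) Cons_nth_drop_Suc[of "Suc m" xs] by auto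
  then show ?thesis
    using assms by (simp add: permute_list_carry nths_remove_nth butlast_conv_take)
qed

lemma nths_remove_nth_not_last:
  assumes "length xs = Suc (Suc m)" "b \<le> m"
  shows "nths (butlast xs) (- {b}) @ [xs ! Suc m] = nths xs (- {b})"
proof -
  have "xs = butlast xs @ [xs ! Suc m]"
    using assms(1) append_butlast_last_id[of xs] by (cases "xs = []") (auto simp: last_conv_nth)
  then have "nths xs (- {b}) = nths (butlast xs @ [xs ! Suc m]) (- {b})"
    by simp
  then show ?thesis
    using assms by (simp add: nths_append)
qed

section \<open>Signed sums over permutations of the leading entries\<close>

lemma minus_one_power_diff:
  assumes "b \<le> m"
  shows "(- 1 :: 'a::comm_ring_1) ^ (m - b) = (- 1) ^ m * (- 1) ^ b"
proof -
  obtain d where "m = b + d" using assms le_Suc_ex by blast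
  then show ?thesis by (simp add: power_add mult_ac)
qed

text \<open>
  The alternator without its factorial and without the restriction on the length of the list. The
  freedom in the length allows the number of permuted entries to decrease in the expansion below
  while the list keeps its length.
\<close>

definition signed_sum ::
    "('k::field \<Rightarrow> 'g::ab_group_add \<Rightarrow> 'g) \<Rightarrow> nat \<Rightarrow> ('g list \<Rightarrow> 'g) \<Rightarrow> 'g list \<Rightarrow> 'g" where
  "signed_sum scale p P xs =
     (\<Sum>\<sigma> | \<sigma> permutes {..<p}. scale (of_int (sign \<sigma>)) (P (permute_list \<sigma> xs)))"

context vector_space
begin

lemma signed_sum_cong:
  assumes "\<And>ys. length ys = length xs \<Longrightarrow> P ys = Q ys"
  shows "signed_sum scale p P xs = signed_sum scale p Q xs"
  unfolding signed_sum_def by (intro sum.cong refl) (simp add: assms)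

lemma signed_sum_add:
  "signed_sum scale p (\<lambda>ys. P ys + Q ys) xs =
    signed_sum scale p P xs + signed_sum scale p Q xs"
  unfolding signed_sum_def by (simp add: scale_right_distrib sum.distrib)

lemma signed_sum_diff:
  "signed_sum scale p (\<lambda>ys. P ys - Q ys) xs =
    signed_sum scale p P xs - signed_sum scale p Q xs"
  unfolding signed_sum_def by (simp add: scale_right_diff_distrib sum_subtractf)

lemma signed_sum_scale:
  "signed_sum scale p (\<lambda>ys. scale c (P ys)) xs = scale c (signed_sum scale p P xs)"
  unfolding signed_sum_def by (simp add: scale_sum_right mult.commute)

lemma signed_sum_sum:
  "signed_sum scale p (\<lambda>ys. \<Sum>i\<in>I. P i ys) xs =
    (\<Sum>i\<in>I. signed_sum scale p (P i) xs)"
  unfolding signed_sum_def scale_sum_right by (rule sum.swap)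

lemma signed_sum_permute:
  assumes "\<tau> permutes {..<p}" "p \<le> length xs"
  shows "signed_sum scale p (\<lambda>ys. P (permute_list \<tau> ys)) xs =
    scale (of_int (sign \<tau>)) (signed_sum scale p P xs)"
proof -
  have \<tau>: "\<tau> permutes {..<length xs}"
    by (rule permutes_subset[OF assms(1)]) (use assms(2) in auto)
  have perm: "permutation \<sigma>" if "\<sigma> permutes {..<p}" for \<sigma>
    using that permutation_permutes by blast
  have "signed_sum scale p P xs = (\<Sum>\<sigma> | \<sigma> permutes {..<p}.
      scale (of_int (sign (\<sigma> \<circ> \<tau>))) (P (permute_list (\<sigma> \<circ> \<tau>) xs)))"
    unfolding signed_sum_def by (rule sum_permutations_compose_right[OF assms(1)])
  also have "\<dots> = scale (of_int (sign \<tau>)) (signed_sum scale p (\<lambda>ys. P (permute_list \<tau> ys)) xs)"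
    unfolding signed_sum_def scale_sum_right
    by (intro sum.cong refl)
      (simp add: perm assms(1) sign_compose permute_list_compose[OF \<tau>] mult.commute)
  finally show ?thesis
    by (simp flip: of_int_mult)
qed

lemma signed_sum_alternating:
  assumes "\<And>\<sigma>. \<sigma> permutes {..<p} \<Longrightarrow> P (permute_list \<sigma> xs) = scale (of_int (sign \<sigma>)) (P xs)"
  shows "signed_sum scale p P xs = scale (of_nat (fact p)) (P xs)"
proof -
  have "signed_sum scale p P xs = (\<Sum>\<sigma> | \<sigma> permutes {..<p}. P xs)"
    unfolding signed_sum_def by (intro sum.cong refl) (simp add: assms flip: of_int_mult)
  also have "\<dots> = scale (of_nat (fact p)) (P xs)"
    by (simp add: sum_constant_scale card_permutations)
  finally show ?thesis .
qed

text \<open>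
  The cosets of the stabiliser of \<open>n\<close> are told apart by the image of \<open>n\<close>. The transpositions of
  \<open>n\<close> and \<open>b\<close> are one system of representatives, and the cycles differ from them by elements of the
  stabiliser, which the inner sum absorbs. The cycles have the advantage that they keep the other
  entries in their order, as the removal of one argument in the coboundary does.
\<close>

lemma sum_permutations_lessThan_Suc:
  "(\<Sum>\<sigma> | \<sigma> permutes {..<Suc n}. f \<sigma>) =
   (\<Sum>b<Suc n. \<Sum>\<tau> | \<tau> permutes {..<n}. f (carry b n \<circ> \<tau>))"
proof -
  have "(\<Sum>\<sigma> | \<sigma> permutes {..<Suc n}. f \<sigma>) =
      (\<Sum>b<Suc n. \<Sum>\<tau> | \<tau> permutes {..<n}. f (transpose n b \<circ> \<tau>))"
    using sum_over_permutations_insert[of "{..<n}" n f] by (simp only: lessThan_Suc) simp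
  also have "\<dots> = (\<Sum>b<Suc n. \<Sum>\<tau> | \<tau> permutes {..<n}. f (carry b n \<circ> \<tau>))"
  proof (rule sum.cong[OF refl])
    fix b assume "b \<in> {..<Suc n}"
    then have b: "b \<le> n" by simp
    define r where "r = inv (carry b n) \<circ> transpose n b"
    have c: "carry b n permutes {..<Suc n}"
      using b by (intro carry_permutes) auto
    have "r permutes {..<Suc n}"
      unfolding r_def
      by (rule permutes_compose[OF permutes_swap_id permutes_inv[OF c]]) (use b in auto)
    moreover have "carry b n n = b"
      using b by (simp add: carry_def)
    then have "r n = n"
      by (simp add: r_def permutes_inv_eq[OF c])
    ultimately have r: "r permutes {..<n}"
      using permutes_superset[of r "{..<Suc n}" "{..<n}"]
      by (auto simp: less_Suc_eq)
    have eq: "transpose n b = carry b n \<circ> r"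
      by (simp add: r_def o_assoc permutes_inv_o[OF c])
    show "(\<Sum>\<tau> | \<tau> permutes {..<n}. f (transpose n b \<circ> \<tau>)) =
        (\<Sum>\<tau> | \<tau> permutes {..<n}. f (carry b n \<circ> \<tau>))"
      unfolding eq setum_permutations_compose_left[OF r, of "\<lambda>\<tau>. f (carry b n \<circ> \<tau>)"] o_assoc ..
  qed
  finally show ?thesis .
qed

lemma signed_sum_Suc:
  assumes "n < length xs"
  shows "signed_sum scale (Suc n) P xs =
    (\<Sum>b<Suc n. scale ((- 1) ^ (n - b)) (signed_sum scale n P (permute_list (carry b n) xs)))"
  unfolding signed_sum_def sum_permutations_lessThan_Suc scale_sum_right
proof (intro sum.cong refl)
  fix b \<tau> assume b: "b \<in> {..<Suc n}" and \<tau>: "\<tau> \<in> {\<tau>. \<tau> permutes {..<n}}"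
  then have "permutation (carry b n)" "permutation \<tau>"
    using carry_permutes[of b n "Suc n"] by (auto simp: permutation_permutes)
  moreover have "\<tau> permutes {..<length xs}"
    by (rule permutes_subset[of \<tau> "{..<n}"]) (use \<tau> assms in auto)
  ultimately show "scale (of_int (sign (carry b n \<circ> \<tau>))) (P (permute_list (carry b n \<circ> \<tau>) xs)) =
      scale ((- 1) ^ (n - b))
        (scale (of_int (sign \<tau>)) (P (permute_list \<tau> (permute_list (carry b n) xs))))"
    using b by (simp add: sign_compose sign_carry permute_list_compose)
qed

text \<open>
  Three of the four sums of the coboundary have this form, for different \<open>H\<close>: each permuted entry
  becomes in turn the distinguished argument \<open>y\<close>, and the inner sum over the orders of the others
  is \<open>m!\<close> equal terms. The last entry \<open>z\<close> of the list is not permuted.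
\<close>

lemma signed_sum_expand:
  assumes len: "length xs = Suc (Suc m)"
    and alt: "\<And>us y z \<sigma>. length us = m \<Longrightarrow> \<sigma> permutes {..<m} \<Longrightarrow>
      H (permute_list \<sigma> us) y z = scale (of_int (sign \<sigma>)) (H us y z)"
  shows "signed_sum scale (Suc m) (\<lambda>ys. H (take m ys) (ys ! m) (ys ! Suc m)) xs =
    scale ((- 1) ^ m * of_nat (fact m))
      (\<Sum>b<Suc m. scale ((- 1) ^ b) (H (nths (butlast xs) (- {b})) (xs ! b) (xs ! Suc m)))"
proof -
  let ?P = "\<lambda>ys. H (take m ys) (ys ! m) (ys ! Suc m)"
  have "signed_sum scale m ?P (permute_list (carry b m) xs) =
      scale (of_nat (fact m)) (H (nths (butlast xs) (- {b})) (xs ! b) (xs ! Suc m))"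
    if "b \<le> m" for b
  proof -
    let ?us = "nths (butlast xs) (- {b})"
    have us: "length ?us = m"
      using that len by (simp add: nths_remove_nth min_def)
    have "signed_sum scale m ?P (?us @ [xs ! b, xs ! Suc m]) =
        scale (of_nat (fact m)) (?P (?us @ [xs ! b, xs ! Suc m]))"
      by (rule signed_sum_alternating)
        (simp add: us permute_list_append alt nth_append)
    then show ?thesis
      by (simp add: permute_list_carry_penultimate[OF len that] us nth_append)
  qed
  then show ?thesis
    using len by (simp add: signed_sum_Suc scale_sum_right minus_one_power_diff mult_ac
        del: sum.lessThan_Suc of_nat_fact)
qed

end

section \<open>The terms of the Gerstenhaber bracket with the product\<close>

text \<open>
  Expanding twice produces the pairs of a position \<open>b\<close> and a position \<open>c\<close> in the list without the
  entry \<open>b\<close>. In the original list \<open>c\<close> has to skip \<open>b\<close>, so that these pairs are the ordered pairs of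
  distinct positions, grouped here by their larger element.
\<close>

lemma sum_ordered_pairs:
  fixes g :: "nat \<Rightarrow> nat \<Rightarrow> 'a::comm_monoid_add"
  shows "(\<Sum>b<Suc n. \<Sum>c<n. g b (if c < b then c else Suc c)) =
    (\<Sum>j<Suc n. \<Sum>i<j. g j i + g i j)"
proof -
  have "(\<Sum>c<n. g b (if c < b then c else Suc c)) = (\<Sum>d\<in>{..<Suc n} - {b}. g b d)"
    if "b < Suc n" for b
    by (rule sum.reindex_bij_witness[where i="\<lambda>d. if d < b then d else d - 1"
          and j="\<lambda>c. if c < b then c else Suc c"]) (use that in auto)
  moreover have "(\<Sum>b<k. \<Sum>d\<in>{..<k} - {b}. g b d) = (\<Sum>j<k. \<Sum>i<j. g j i + g i j)" for k
  proof (induction k)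
    case (Suc k)
    have "(\<Sum>d\<in>{..<Suc k} - {b}. g b d) = (\<Sum>d\<in>{..<k} - {b}. g b d) + g b k" if "b < k" for b
    proof -
      have "{..<Suc k} - {b} = insert k ({..<k} - {b})"
        using that by auto
      then show ?thesis by (simp add: add.commute)
    qed
    moreover have "{..<Suc k} - {k} = {..<k}" by auto
    ultimately show ?case
      using Suc by (simp add: sum.distrib add_ac)
  qed simp
  ultimately show ?thesis by simp
qed

context
  fixes scale :: "'k::field_char_0 \<Rightarrow> 'g::ab_group_add \<Rightarrow> 'g"
    and \<pi> :: "'g \<Rightarrow> 'g \<Rightarrow> 'g" and \<phi> :: "'g list \<Rightarrow> 'g" and m :: nat
  assumes vector_space_scale: "vector_space scale"
    and pi_left: "\<And>y. Vector_Spaces.linear scale scale (\<lambda>x. \<pi> x y)"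
    and pi_right: "\<And>x. Vector_Spaces.linear scale scale (\<lambda>y. \<pi> x y)"
    and phi: "\<phi> \<in> C_space scale m"
begin

interpretation vector_space scale by (rule vector_space_scale)

lemma pi_scale: "\<pi> (scale c x) y = scale c (\<pi> x y)" "\<pi> x (scale c y) = scale c (\<pi> x y)"
  using pi_left pi_right by (simp_all add: Vector_Spaces.linear_iff_module_hom module_hom_iff)

lemma phi_permute:
  assumes "length us = m" "\<sigma> permutes {..<m}"
  shows "\<phi> (permute_list \<sigma> us @ [z]) = scale (of_int (sign \<sigma>)) (\<phi> (us @ [z]))"
  using alternating_permute[OF vector_space_scale phi assms(2), of "us @ [z]"] assms
  by (simp add: permute_list_append)

lemma phi_move_front:
  assumes "Suc (length us + length vs) = m"
  shows "\<phi> (us @ w # vs @ [z]) = scale ((- 1) ^ length us) (\<phi> (w # us @ vs @ [z]))"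
proof -
  have "carry 0 (length us) permutes {..<m}"
    by (rule carry_permutes) (use assms in auto)
  then have "\<phi> (permute_list (carry 0 (length us)) (w # us @ vs @ [z])) =
      scale (of_int (sign (carry 0 (length us)))) (\<phi> (w # us @ vs @ [z]))"
    by (rule alternating_permute[OF vector_space_scale phi]) (use assms in simp)
  then show ?thesis
    using permute_list_carry_append[of "[]" us w "vs @ [z]"] by (simp add: sign_carry)
qed

text \<open>
  The alternating arguments of \<open>\<phi>\<close> include \<open>w\<close> and the entries of \<open>us\<close>. Moving \<open>w\<close> behind \<open>us\<close> and
  back turns a permutation of \<open>us\<close> into one of leading entries, and the two signs cancel.
\<close>

lemma phi_permute_tail:
  assumes "Suc (length us) = m" "\<sigma> permutes {..<length us}"
  shows "\<phi> (w # permute_list \<sigma> us @ [z]) = scale (of_int (sign \<sigma>)) (\<phi> (w # us @ [z]))"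
proof -
  have "\<sigma> permutes {..<m}"
    by (rule permutes_subset[OF assms(2)]) (use assms(1) in auto)
  moreover have "length (permute_list \<sigma> us) = length us" by simp
  ultimately have "scale ((- 1) ^ length us) (\<phi> (w # permute_list \<sigma> us @ [z])) =
      scale ((- 1) ^ length us) (scale (of_int (sign \<sigma>)) (\<phi> (w # us @ [z])))"
    using phi_permute[of "us @ [w]" \<sigma> z] phi_move_front[of us "[]" w z]
      phi_move_front[of "permute_list \<sigma> us" "[]" w z] assms
    by (simp add: permute_list_append mult.commute)
  then show ?thesis
    unfolding scale_cancel_left by simp
qed

lemma signed_sum_mul_phi_last:
  assumes "length xs = Suc (Suc m)"
  shows "signed_sum scale (Suc m) (\<lambda>ys. \<pi> (\<phi> (take (Suc m) ys)) (ys ! Suc m)) xs =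
    scale ((- 1) ^ m * of_nat (fact m))
      (\<Sum>b<Suc m. scale ((- 1) ^ b) (\<pi> (\<phi> (nths (butlast xs) (- {b}) @ [xs ! b])) (xs ! Suc m)))"
proof -
  have "signed_sum scale (Suc m) (\<lambda>ys. \<pi> (\<phi> (take (Suc m) ys)) (ys ! Suc m)) xs =
      signed_sum scale (Suc m) (\<lambda>ys. \<pi> (\<phi> (take m ys @ [ys ! m])) (ys ! Suc m)) xs"
    by (rule signed_sum_cong) (simp add: assms take_Suc_conv_app_nth)
  also have "\<dots> = scale ((- 1) ^ m * of_nat (fact m))
      (\<Sum>b<Suc m. scale ((- 1) ^ b) (\<pi> (\<phi> (nths (butlast xs) (- {b}) @ [xs ! b])) (xs ! Suc m)))"
    by (rule signed_sum_expand[OF assms, where H="\<lambda>us y z. \<pi> (\<phi> (us @ [y])) z"])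
      (simp add: phi_permute pi_scale)
  finally show ?thesis .
qed

lemma signed_sum_phi_mul_last:
  assumes "length xs = Suc (Suc m)"
  shows "signed_sum scale (Suc m) (\<lambda>ys. \<phi> (take m ys @ [\<pi> (ys ! m) (ys ! Suc m)])) xs =
    scale ((- 1) ^ m * of_nat (fact m))
      (\<Sum>b<Suc m. scale ((- 1) ^ b) (\<phi> (nths (butlast xs) (- {b}) @ [\<pi> (xs ! b) (xs ! Suc m)])))"
  by (rule signed_sum_expand[OF assms, where H="\<lambda>us y z. \<phi> (us @ [\<pi> y z])"])
    (simp add: phi_permute)

text \<open>
  Here the distinguished argument stands first. Carrying it to position \<open>m\<close> costs \<open>(- 1)\<^sup>m\<close>, which
  cancels the sign in the expansion along position \<open>m\<close>.
\<close>

lemma signed_sum_mul_first_phi: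
  assumes "length xs = Suc (Suc m)"
  shows "signed_sum scale (Suc m) (\<lambda>ys. \<pi> (ys ! 0) (\<phi> (tl ys))) xs =
    scale (of_nat (fact m)) (\<Sum>b<Suc m. scale ((- 1) ^ b) (\<pi> (xs ! b) (\<phi> (nths xs (- {b})))))"
proof -
  let ?H = "\<lambda>us y z. \<pi> y (\<phi> (us @ [z]))"
  let ?K = "\<lambda>ys. ?H (take m ys) (ys ! m) (ys ! Suc m)"
  have "signed_sum scale (Suc m) (\<lambda>ys. \<pi> (ys ! 0) (\<phi> (tl ys))) xs =
      signed_sum scale (Suc m) (\<lambda>ys. ?K (permute_list (carry 0 m) ys)) xs"
  proof (rule signed_sum_cong)
    fix ys :: "'g list" assume "length ys = length xs"
    then have "length (tl ys) = Suc m" "ys = hd ys # tl ys"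
      using assms by (cases ys; simp)+
    then obtain y us z where "ys = y # us @ [z]" "length us = m"
      by (metis length_Suc_conv_rev)
    then show "\<pi> (ys ! 0) (\<phi> (tl ys)) = ?K (permute_list (carry 0 m) ys)"
      using permute_list_carry_append[of "[]" us y "[z]"] by (simp add: nth_append)
  qed
  also have "\<dots> = scale (of_int (sign (carry 0 m))) (signed_sum scale (Suc m) ?K xs)"
    by (rule signed_sum_permute) (use assms carry_permutes[of 0 m "Suc m"] in auto)
  also have "signed_sum scale (Suc m) ?K xs = scale ((- 1) ^ m * of_nat (fact m))
      (\<Sum>b<Suc m. scale ((- 1) ^ b) (?H (nths (butlast xs) (- {b})) (xs ! b) (xs ! Suc m)))"
    by (rule signed_sum_expand[OF assms]) (simp add: phi_permute pi_scale)
  finally show ?thesis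
    by (simp add: sign_carry nths_remove_nth_not_last[OF assms] del: sum.lessThan_Suc of_nat_fact)
qed

text \<open>
  Carrying the entry at \<open>i\<close> to position \<open>m\<close> twice moves the pair at \<open>i\<close> and \<open>i + 1\<close> to the positions
  \<open>m - 1\<close> and \<open>m\<close>. The permutation is a square and therefore even. The sign \<open>(- 1)\<^sup>i\<close> comes only from
  moving the product to the front slot of \<open>\<phi>\<close>.
\<close>

lemma signed_sum_phi_mul_adjacent:
  assumes len: "length xs = Suc (Suc m)" and "i < m"
  shows "signed_sum scale (Suc m)
      (\<lambda>ys. \<phi> (take i ys @ [\<pi> (ys ! i) (ys ! Suc i)] @ drop (Suc (Suc i)) ys)) xs =
    scale ((- 1) ^ i) (signed_sum scale (Suc m)
      (\<lambda>ys. \<phi> (\<pi> (ys ! (m - 1)) (ys ! m) # take (m - 1) ys @ [ys ! Suc m])) xs)"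
proof -
  let ?K = "\<lambda>ys. \<phi> (\<pi> (ys ! (m - 1)) (ys ! m) # take (m - 1) ys @ [ys ! Suc m])"
  let ?c = "carry i m"
  have c: "?c permutes {..<n}" if "m < n" for n
    using that assms by (intro carry_permutes) auto
  have "signed_sum scale (Suc m)
      (\<lambda>ys. \<phi> (take i ys @ [\<pi> (ys ! i) (ys ! Suc i)] @ drop (Suc (Suc i)) ys)) xs =
    signed_sum scale (Suc m)
      (\<lambda>ys. scale ((- 1) ^ i) (?K (permute_list ?c (permute_list ?c ys)))) xs"
  proof (rule signed_sum_cong)
    fix ys :: "'g list" assume ys: "length ys = length xs"
    define us y y' vs z where "us = take i ys" and "y = ys ! i" and "y' = ys ! Suc i"
      and "vs = drop (Suc (Suc i)) (take (Suc m) ys)" and "z = ys ! Suc m"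
    have "drop (Suc (Suc i)) ys = vs @ [z]"
    proof -
      have "ys = take (Suc m) ys @ [z]"
        using ys len by (simp add: z_def flip: take_Suc_conv_app_nth)
      then have "drop (Suc (Suc i)) ys = drop (Suc (Suc i)) (take (Suc m) ys @ [z])"
        by simp
      then show ?thesis
        using assms ys by (simp add: vs_def)
    qed
    moreover have "drop i ys = y # y' # drop (Suc (Suc i)) ys"
      using assms ys by (simp add: y_def y'_def Cons_nth_drop_Suc)
    ultimately have eq: "ys = us @ y # y' # vs @ [z]"
      using append_take_drop_id[of i ys] by (simp add: us_def)
    have l: "length us = i" "Suc (length us + length vs) = m"
      using assms ys by (simp_all add: us_def vs_def)
    have "permute_list ?c ys = us @ y' # vs @ [y, z]"
      using permute_list_carry_append[of us "y' # vs" y "[z]"] l by (simp add: eq)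
    moreover have "permute_list ?c (us @ y' # vs @ [y, z]) = us @ vs @ [y, y', z]"
      using permute_list_carry_append[of us "vs @ [y]" y' "[z]"] l by simp
    ultimately have "permute_list ?c (permute_list ?c ys) = us @ vs @ [y, y', z]"
      by simp
    moreover have "?K (us @ vs @ [y, y', z]) = \<phi> (\<pi> y y' # us @ vs @ [z])"
      unfolding l(2)[symmetric] by (simp add: nth_append)
    moreover have "take i ys @ [\<pi> (ys ! i) (ys ! Suc i)] @ drop (Suc (Suc i)) ys =
        us @ \<pi> y y' # vs @ [z]"
      unfolding eq l(1)[symmetric] by (simp add: nth_append)
    ultimately show "\<phi> (take i ys @ [\<pi> (ys ! i) (ys ! Suc i)] @ drop (Suc (Suc i)) ys) =
        scale ((- 1) ^ i) (?K (permute_list ?c (permute_list ?c ys)))"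
      using phi_move_front[OF l(2), of "\<pi> y y'" z] l(1) by (simp only:)
  qed
  also have "\<dots> = scale ((- 1) ^ i) (scale (of_int (sign ?c)) (scale (of_int (sign ?c))
      (signed_sum scale (Suc m) ?K xs)))"
    using signed_sum_permute[OF c, of "Suc m" xs "\<lambda>ys. ?K (permute_list ?c ys)"]
      signed_sum_permute[OF c, of "Suc m" xs ?K] len
    by (simp add: signed_sum_scale)
  finally show ?thesis
    by (simp flip: of_int_mult)
qed

lemma phi_add_hd:
  assumes "length us = m"
  shows "\<phi> ((a + b) # us) = \<phi> (a # us) + \<phi> (b # us)"
proof -
  have add: "\<forall>xs i a b. length xs = Suc m \<longrightarrow> i < Suc m \<longrightarrow>
      \<phi> (xs[i := a + b]) = \<phi> (xs[i := a]) + \<phi> (xs[i := b])"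
    using phi unfolding C_space_def wedge_hom_def by (simp add: multilinear_maps_iff)
  show ?thesis
    using add[rule_format, of "0 # us" 0 a b] assms by simp
qed

lemma phi_diff_hd:
  assumes "length us = m"
  shows "\<phi> ((a - b) # us) = \<phi> (a # us) - \<phi> (b # us)"
  using phi_add_hd[OF assms, of "a - b" b] by (simp add: algebra_simps)

text \<open>
  Expansion along the positions \<open>m\<close> and \<open>m - 1\<close> picks the two factors of the product in every order.
  Interchanging them flips the sign, since the later of two positions is one place lower once
  the earlier one has been removed; this difference in sign produces the commutator.
\<close>

lemma signed_sum_phi_mul_penultimate:
  assumes m: "m = Suc l" and len: "length xs = Suc (Suc m)"
  shows "signed_sum scale (Suc m)
      (\<lambda>ys. \<phi> (\<pi> (ys ! (m - 1)) (ys ! m) # take (m - 1) ys @ [ys ! Suc m])) xs =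
    - scale (of_nat (fact l)) (\<Sum>j<Suc m. \<Sum>i<j. scale ((- 1) ^ (i + j))
      (\<phi> ((\<pi> (xs ! i) (xs ! j) - \<pi> (xs ! j) (xs ! i)) # nths xs (- {i, j}))))"
proof -
  let ?K = "\<lambda>ys. \<phi> (\<pi> (ys ! (m - 1)) (ys ! m) # take (m - 1) ys @ [ys ! Suc m])"
  let ?skip = "\<lambda>b c. if c < b then c else Suc c"
  \<comment> \<open>\<open>b\<close> is the position of the right factor and \<open>d\<close> that of the left factor\<close>
  define g where "g b d = scale (of_nat (fact l) * (if d < b then - 1 else 1) * (- 1) ^ (b + d))
      (\<phi> (\<pi> (xs ! d) (xs ! b) # nths xs (- {b, d})))" for b d
  have inner: "signed_sum scale l ?K (permute_list (carry c l) (permute_list (carry b m) xs)) =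
      scale (of_nat (fact l))
        (\<phi> (\<pi> (xs ! ?skip b c) (xs ! b) # nths xs (- {b, ?skip b c})))"
    if b: "b \<le> m" and c: "c < m" for b c
  proof -
    define us where "us = nths (butlast xs) (- {b})"
    define vs where "vs = take c us @ drop (Suc c) us"
    have us: "length us = m" "us = take b (butlast xs) @ drop (Suc b) (butlast xs)"
      using b len by (simp_all add: us_def nths_remove_nth min_def)
    have vs: "length vs = l"
      using us(1) c m by (simp add: vs_def)
    have "permute_list (carry c l) (us @ [xs ! b, xs ! Suc m]) = vs @ [us ! c, xs ! b, xs ! Suc m]"
      using us(1) c m by (simp add: permute_list_carry vs_def nth_append)
    moreover have "us ! c = xs ! ?skip b c"
      using b c len unfolding us(2) by (simp add: nth_append nth_butlast min_def)
    moreover have "vs @ [xs ! Suc m] = nths xs (- {b, ?skip b c})"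
    proof -
      have "vs @ [xs ! Suc m] = take c (us @ [xs ! Suc m]) @ drop (Suc c) (us @ [xs ! Suc m])"
        using c us(1) by (simp add: vs_def)
      also have "us @ [xs ! Suc m] = nths xs (- {b})"
        unfolding us_def using nths_remove_nth_not_last[OF len b] .
      also have "take c (nths xs (- {b})) @ drop (Suc c) (nths xs (- {b})) =
          nths xs (- {b, ?skip b c})"
      proof (cases "c < b")
        case True
        then show ?thesis
          using nths_remove_two[of c b xs] b len by (simp add: insert_commute)
      next
        case False
        then show ?thesis
          using nths_remove_two'[of b "Suc c" xs] c len by simp
      qed
      finally show ?thesis .
    qed
    moreover have "signed_sum scale l ?K (vs @ [w, y, z]) = scale (of_nat (fact l)) (?K (vs @ [w, y, z]))"
      for w y z
    proof (rule signed_sum_alternating)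
      fix \<sigma> assume \<sigma>: "\<sigma> permutes {..<l}"
      show "?K (permute_list \<sigma> (vs @ [w, y, z])) = scale (of_int (sign \<sigma>)) (?K (vs @ [w, y, z]))"
        using phi_permute_tail[of vs \<sigma> "\<pi> w y" z] \<sigma> vs m
        by (simp add: permute_list_append nth_append)
    qed
    ultimately show ?thesis
      using permute_list_carry_penultimate[OF len b] vs m by (simp add: us_def nth_append)
  qed
  have "signed_sum scale (Suc m) ?K xs =
      (\<Sum>b<Suc m. scale ((- 1) ^ (m - b)) (\<Sum>c<m. scale ((- 1) ^ (l - c))
        (signed_sum scale l ?K (permute_list (carry c l) (permute_list (carry b m) xs)))))"
    using len m by (simp add: signed_sum_Suc del: sum.lessThan_Suc)
  also have "\<dots> = (\<Sum>b<Suc m. \<Sum>c<m. g b (?skip b c))"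
    unfolding scale_sum_right
  proof (intro sum.cong refl)
    fix b c assume "b \<in> {..<Suc m}" "c \<in> {..<m}"
    then have b: "b \<le> m" and c: "c < m" by auto
    have "(- 1 :: 'k) ^ (m - b) * (- 1) ^ (l - c) = - ((- 1) ^ (b + c))"
      using b c m by (simp add: minus_one_power_diff power_add mult_ac)
    then have "(- 1) ^ (m - b) * (- 1) ^ (l - c) * of_nat (fact l) = of_nat (fact l) *
        (if ?skip b c < b then - 1 else 1) * (- 1 :: 'k) ^ (b + ?skip b c)"
      by (cases "c < b") simp_all
    then show "scale ((- 1) ^ (m - b)) (scale ((- 1) ^ (l - c))
        (signed_sum scale l ?K (permute_list (carry c l) (permute_list (carry b m) xs)))) =
        g b (?skip b c)"
      unfolding inner[OF b c] g_def scale_scale by (simp only: mult.assoc)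
  qed
  also have "\<dots> = (\<Sum>j<Suc m. \<Sum>i<j. g j i + g i j)"
    by (rule sum_ordered_pairs)
  also have "\<dots> = (\<Sum>j<Suc m. \<Sum>i<j. - scale (of_nat (fact l)) (scale ((- 1) ^ (i + j))
      (\<phi> ((\<pi> (xs ! i) (xs ! j) - \<pi> (xs ! j) (xs ! i)) # nths xs (- {i, j})))))"
  proof (intro sum.cong refl)
    fix j i assume "j \<in> {..<Suc m}" "i \<in> {..<j}"
    then have ij: "i < j" "j < length xs" using len by auto
    then have "length (nths xs (- {i, j})) = m"
      using len by (simp add: nths_remove_two nths_remove_nth min_def)
    then show "g j i + g i j = - scale (of_nat (fact l)) (scale ((- 1) ^ (i + j))
        (\<phi> ((\<pi> (xs ! i) (xs ! j) - \<pi> (xs ! j) (xs ! i)) # nths xs (- {i, j}))))"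
      using ij unfolding g_def
      by (simp add: phi_diff_hd scale_right_diff_distrib insert_commute add.commute)
  qed
  finally show ?thesis
    by (simp add: sum_negf scale_sum_right del: sum.lessThan_Suc of_nat_fact)
qed

lemma G_bracket_product_cochain:
  assumes len: "length ys = Suc (Suc m)"
  shows "G_bracket scale 1 m (product_cochain \<pi>) \<phi> ys =
      \<pi> (\<phi> (take (Suc m) ys)) (ys ! Suc m) + scale ((- 1) ^ m) (\<pi> (ys ! 0) (\<phi> (tl ys)))
    - scale ((- 1) ^ m)
        ((\<Sum>i<m. scale ((- 1) ^ i)
            (\<phi> (take i ys @ [\<pi> (ys ! i) (ys ! Suc i)] @ drop (Suc (Suc i)) ys)))
        + scale ((- 1) ^ m) (\<phi> (take m ys @ [\<pi> (ys ! m) (ys ! Suc m)])))"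
proof -
  have pair: "take 2 (drop i ys) = [ys ! i, ys ! Suc i]" if "i < Suc m" for i
  proof -
    have "drop i ys = ys ! i # ys ! Suc i # drop (Suc (Suc i)) ys"
      using that len by (simp add: Cons_nth_drop_Suc)
    then show ?thesis by (simp add: numeral_2_eq_2)
  qed
  obtain t ts where ys: "ys = t # ts" "length ts = Suc m"
    using len by (cases ys) auto
  then have "drop m ts = [ts ! m]"
    using Cons_nth_drop_Suc[of m ts] by simp
  then have 1: "circ scale 1 m (product_cochain \<pi>) \<phi> ys =
      \<pi> (\<phi> (take (Suc m) ys)) (ys ! Suc m) + scale ((- 1) ^ m) (\<pi> (ys ! 0) (\<phi> (tl ys)))"
    by (simp add: circ_def product_cochain_def numeral_2_eq_2 ys)
  have "circ scale m 1 \<phi> (product_cochain \<pi>) ys = (\<Sum>i<Suc m. scale ((- 1) ^ i)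
      (\<phi> (take i ys @ [\<pi> (ys ! i) (ys ! Suc i)] @ drop (Suc (Suc i)) ys)))"
    using len by (simp add: circ_def product_cochain_def pair del: sum.lessThan_Suc)
  then show ?thesis
    using len 1 by (simp add: G_bracket_def)
qed

text \<open>
  In \<open>\<delta>\<close> the factor \<open>(m + 1)! / m!\<close> of the bracket and \<open>1 / (m + 1)!\<close> of the alternator leave \<open>1 / m!\<close>,
  which cancels the \<open>m!\<close> of the four expansions.
\<close>

lemma delta_formula:
  assumes len: "length xs = Suc (Suc m)"
  shows "delta scale \<pi> m \<phi> xs =
        (\<Sum>i<Suc m. scale ((- 1) ^ i) (\<pi> (xs ! i) (\<phi> (nths xs (- {i})))))
      + (\<Sum>i<Suc m. scale ((- 1) ^ i) (\<pi> (\<phi> (nths (butlast xs) (- {i}) @ [xs ! i])) (xs ! Suc m)))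
      - (\<Sum>i<Suc m. scale ((- 1) ^ i)
          (\<phi> (nths (butlast xs) (- {i}) @ [\<pi> (xs ! i) (xs ! Suc m)])))
      + (\<Sum>j<Suc m. \<Sum>i<j. scale ((- 1) ^ (i + j))
          (\<phi> ((\<pi> (xs ! i) (xs ! j) - \<pi> (xs ! j) (xs ! i)) # nths xs (- {i, j}))))"
    (is "_ = ?A + ?B - ?C + ?D")
proof -
  let ?S = "signed_sum scale (Suc m)"
  let ?T = "\<lambda>i ys. \<phi> (take i ys @ [\<pi> (ys ! i) (ys ! Suc i)] @ drop (Suc (Suc i)) ys)"
  let ?f = "of_nat (fact m) :: 'k"
  \<comment> \<open>for \<open>m = 0\<close> both sides vanish, there being no pair of positions\<close>
  have middle: "(\<Sum>i<m. scale ((- 1) ^ i) (?S (?T i) xs)) = - scale ?f ?D"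
  proof (cases m)
    case (Suc l)
    have "(\<Sum>i<m. scale ((- 1) ^ i) (?S (?T i) xs)) = (\<Sum>i<m. - scale (of_nat (fact l)) ?D)"
    proof (rule sum.cong[OF refl])
      fix i assume "i \<in> {..<m}"
      then have i: "i < m" by simp
      show "scale ((- 1) ^ i) (?S (?T i) xs) = - scale (of_nat (fact l)) ?D"
        unfolding signed_sum_phi_mul_adjacent[OF len i]
          signed_sum_phi_mul_penultimate[OF Suc len]
        by simp
    qed
    also have "\<dots> = - scale (of_nat m * of_nat (fact l)) ?D"
      by (simp add: sum_constant_scale sum_negf del: of_nat_fact)
    also have "of_nat m * of_nat (fact l) = ?f"
      by (simp add: Suc algebra_simps)
    finally show ?thesis .
  qed simp
  have S: "?S (G_bracket scale 1 m (product_cochain \<pi>) \<phi>) xs =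
      scale ((- 1) ^ m * ?f) ?B + scale ((- 1) ^ m) (scale ?f ?A)
      - scale ((- 1) ^ m) (- scale ?f ?D + scale ((- 1) ^ m) (scale ((- 1) ^ m * ?f) ?C))"
  proof -
    have "?S (G_bracket scale 1 m (product_cochain \<pi>) \<phi>) xs = ?S (\<lambda>ys.
        \<pi> (\<phi> (take (Suc m) ys)) (ys ! Suc m) + scale ((- 1) ^ m) (\<pi> (ys ! 0) (\<phi> (tl ys)))
        - scale ((- 1) ^ m) ((\<Sum>i<m. scale ((- 1) ^ i) (?T i ys))
          + scale ((- 1) ^ m) (\<phi> (take m ys @ [\<pi> (ys ! m) (ys ! Suc m)])))) xs"
      by (rule signed_sum_cong, rule G_bracket_product_cochain) (simp add: len)
    then show ?thesis
      unfolding signed_sum_add signed_sum_diff signed_sum_scale signed_sum_sum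
        middle signed_sum_mul_phi_last[OF len] signed_sum_mul_first_phi[OF len]
        signed_sum_phi_mul_last[OF len] .
  qed
  have "delta scale \<pi> m \<phi> xs =
      scale ((- 1) ^ m / ?f) (?S (G_bracket scale 1 m (product_cochain \<pi>) \<phi>) xs)"
    using len by (simp add: delta_def C_bracket_def alternator_def signed_sum_def del: fact_Suc)
  also have "\<dots> = ?A + ?B - ?C + ?D"
    unfolding S
    by (simp add: scale_right_distrib scale_right_diff_distrib del: sum.lessThan_Suc)
  finally show ?thesis .
qed

end

section \<open>The bracket stays inside the cochain spaces\<close>

context
  fixes scale :: "'k::field_char_0 \<Rightarrow> 'g::ab_group_add \<Rightarrow> 'g"
  assumes vector_space_scale: "vector_space scale"
begin

interpretation vector_space scale by (rule vector_space_scale)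

text \<open>
  Linearity in the entry at a place of a concatenation is easier to combine with \<^const>\<open>take\<close> and
  \<^const>\<open>drop\<close> than linearity stated with list updates.
\<close>

lemma A_space_iff:
  "P \<in> A_space scale p \<longleftrightarrow> (\<forall>xs. length xs \<noteq> Suc p \<longrightarrow> P xs = 0) \<and>
    (\<forall>us vs a b c. Suc (length us + length vs) = Suc p \<longrightarrow>
      P (us @ (a + b) # vs) = P (us @ a # vs) + P (us @ b # vs) \<and>
      P (us @ scale c a # vs) = scale c (P (us @ a # vs)))"
    (is "_ \<longleftrightarrow> ?zero \<and> ?lin")
proof -
  have "?lin \<longleftrightarrow> (\<forall>xs i a b c. length xs = Suc p \<longrightarrow> i < Suc p \<longrightarrow>
      P (xs[i := a + b]) = P (xs[i := a]) + P (xs[i := b]) \<and>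
      P (xs[i := scale c a]) = scale c (P (xs[i := a])))" (is "_ \<longleftrightarrow> ?upd")
  proof
    assume lin: ?lin
    show ?upd
    proof (intro allI impI)
      fix xs :: "'g list" and i a b c assume "length xs = Suc p" "i < Suc p"
      then show "P (xs[i := a + b]) = P (xs[i := a]) + P (xs[i := b]) \<and>
          P (xs[i := scale c a]) = scale c (P (xs[i := a]))"
        using lin[rule_format, of "take i xs" "drop (Suc i) xs" a b c]
        by (simp add: upd_conv_take_nth_drop)
    qed
  next
    assume upd: ?upd
    show ?lin
    proof (intro allI impI)
      fix us vs :: "'g list" and a b c assume "Suc (length us + length vs) = Suc p"
      then show "P (us @ (a + b) # vs) = P (us @ a # vs) + P (us @ b # vs) \<and>
          P (us @ scale c a # vs) = scale c (P (us @ a # vs))"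
        using upd[rule_format, of "us @ 0 # vs" "length us" a b c] by simp
    qed
  qed
  then show ?thesis
    unfolding A_space_def multilinear_maps_iff by auto
qed

text \<open>
  The varied argument lies before, inside or after the block that is fed to \<open>Q\<close>. It reaches \<open>P\<close>
  directly, or through \<open>Q\<close>.
\<close>

lemma circ_summand_linear:
  assumes P: "P \<in> A_space scale p" and Q: "Q \<in> A_space scale q"
    and i: "i \<le> p" and len: "length us + length vs = p + q"
  defines "F \<equiv> \<lambda>xs. P (take i xs @ [Q (take (Suc q) (drop i xs))] @ drop (i + Suc q) xs)"
  shows "F (us @ (a + b) # vs) = F (us @ a # vs) + F (us @ b # vs)"
    and "F (us @ scale c a # vs) = scale c (F (us @ a # vs))"
proof -
  have linP: "P (us @ (a + b) # vs) = P (us @ a # vs) + P (us @ b # vs)"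
      "P (us @ scale c a # vs) = scale c (P (us @ a # vs))"
    if "length us + length vs = p" for us vs a b c
    using P that unfolding A_space_iff by auto
  have linQ: "Q (us @ (a + b) # vs) = Q (us @ a # vs) + Q (us @ b # vs)"
      "Q (us @ scale c a # vs) = scale c (Q (us @ a # vs))"
    if "length us + length vs = q" for us vs a b c
    using Q that unfolding A_space_iff by auto
  consider (before) "length us < i" | (inside) "i \<le> length us" "length us \<le> i + q"
    | (after) "i + q < length us" by linarith
  then have "F (us @ (a + b) # vs) = F (us @ a # vs) + F (us @ b # vs) \<and>
      F (us @ scale c a # vs) = scale c (F (us @ a # vs))"
  proof cases
    case before
    then obtain k where k: "i = Suc (length us + k)"
      using less_imp_Suc_add by blast
    have "F (us @ x # vs) =
        P (us @ x # take k vs @ [Q (take (Suc q) (drop k vs))] @ drop (k + Suc q) vs)" for x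
      by (simp add: F_def k)
    then show ?thesis
      using i len k by (simp add: linP)
  next
    case inside
    then obtain k where k: "length us = i + k" "k \<le> q"
      using le_Suc_ex by force
    have "F (us @ x # vs) =
        P (take i us @ Q (drop i us @ x # take (q - k) vs) # drop (q - k) vs)" for x
      using k by (simp add: F_def Suc_diff_le)
    then show ?thesis
      using i len k by (simp add: linP linQ)
  next
    case after
    then obtain k where k: "length us = Suc (i + q + k)"
      using less_imp_Suc_add by blast
    have "F (us @ x # vs) =
        P ((take i us @ Q (take (Suc q) (drop i us)) # drop (i + Suc q) us) @ x # vs)" for x
      using k by (simp add: F_def)
    then show ?thesis
      using i len k linP[of "take i us @ Q (take (Suc q) (drop i us)) # drop (i + Suc q) us" vs]
      by simp
  qed
  then show "F (us @ (a + b) # vs) = F (us @ a # vs) + F (us @ b # vs)"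
    "F (us @ scale c a # vs) = scale c (F (us @ a # vs))" by auto
qed

lemma circ_in_A_space:
  assumes P: "P \<in> A_space scale p" and Q: "Q \<in> A_space scale q"
  shows "circ scale p q P Q \<in> A_space scale (p + q)"
  unfolding A_space_iff
proof (intro conjI allI impI)
  fix us vs :: "'g list" and a b c assume "Suc (length us + length vs) = Suc (p + q)"
  then have len: "length us + length vs = p + q" by simp
  show "circ scale p q P Q (us @ (a + b) # vs) =
      circ scale p q P Q (us @ a # vs) + circ scale p q P Q (us @ b # vs)"
    using circ_summand_linear(1)[OF P Q _ len, of _ a b] len
    by (simp add: circ_def scale_right_distrib less_Suc_eq_le flip: sum.distrib del: sum.lessThan_Suc)
  show "circ scale p q P Q (us @ scale c a # vs) = scale c (circ scale p q P Q (us @ a # vs))"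
    using circ_summand_linear(2)[OF P Q _ len, of _ c a] len
    by (simp add: circ_def scale_sum_right less_Suc_eq_le mult.commute del: sum.lessThan_Suc)
qed (simp add: circ_def)

lemma G_bracket_in_A_space:
  assumes P: "P \<in> A_space scale p" and Q: "Q \<in> A_space scale q"
  shows "G_bracket scale p q P Q \<in> A_space scale (p + q)"
  using circ_in_A_space[OF P Q] circ_in_A_space[OF Q P] unfolding A_space_iff G_bracket_def
  by (auto simp: scale_right_distrib scale_right_diff_distrib mult.commute add.commute)

lemma C_space_scale:
  assumes "P \<in> C_space scale p"
  shows "(\<lambda>xs. scale c (P xs)) \<in> C_space scale p"
  using assms unfolding C_space_def wedge_hom_def multilinear_maps_iff
  by (auto simp: scale_right_distrib mult.commute)

lemma delta_in_C_space:
  assumes pi_left: "\<And>y. Vector_Spaces.linear scale scale (\<lambda>x. \<pi> x y)"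
    and pi_right: "\<And>x. Vector_Spaces.linear scale scale (\<lambda>y. \<pi> x y)"
    and phi: "\<phi> \<in> C_space scale m"
  shows "delta scale \<pi> m \<phi> \<in> C_space scale (Suc m)"
proof -
  have "product_cochain \<pi> \<in> A_space scale 1"
    unfolding A_space_def multilinear_maps_def
    using pi_left pi_right by (auto simp: product_cochain_def less_Suc_eq nth_list_update)
  moreover have "\<phi> \<in> A_space scale m"
    using phi by (simp add: C_space_def wedge_hom_def A_space_def)
  ultimately have "G_bracket scale 1 m (product_cochain \<pi>) \<phi> \<in> A_space scale (1 + m)"
    by (rule G_bracket_in_A_space)
  then have "alternator scale (Suc m) (G_bracket scale 1 m (product_cochain \<pi>) \<phi>)
      \<in> C_space scale (Suc m)"
    unfolding alternator_image[OF vector_space_scale] by simp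
  then show ?thesis
    unfolding delta_def C_bracket_def by (simp add: C_space_scale)
qed

end

theorem proposition3p3:
  fixes scale :: "'k::{alg_closed_field,field_char_0} \<Rightarrow> 'g::ab_group_add \<Rightarrow> 'g"
    and Basis :: "'g set"
    and \<pi> :: "'g \<Rightarrow> 'g \<Rightarrow> 'g"
    and n :: nat
    and \<phi> :: "'g list \<Rightarrow> 'g"
  assumes "pre_lie_algebra scale Basis \<pi>"
    and "n \<ge> 1"
    and "\<phi> \<in> C_space scale (n - 1)"
  shows "delta scale \<pi> (n - 1) \<phi> \<in> C_space scale n \<and>
    (\<forall>xs. length xs = n + 1 \<longrightarrow>
      delta scale \<pi> (n - 1) \<phi> xs =
        (\<Sum>i<n. scale ((- 1) ^ i) (\<pi> (xs ! i) (\<phi> (nths xs (- {i})))))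
      + (\<Sum>i<n. scale ((- 1) ^ i) (\<pi> (\<phi> (nths (butlast xs) (- {i}) @ [xs ! i])) (xs ! n)))
      - (\<Sum>i<n. scale ((- 1) ^ i) (\<phi> (nths (butlast xs) (- {i}) @ [\<pi> (xs ! i) (xs ! n)])))
      + (\<Sum>j<n. \<Sum>i<j. scale ((- 1) ^ (i + j))
          (\<phi> ((\<pi> (xs ! i) (xs ! j) - \<pi> (xs ! j) (xs ! i)) # nths xs (- {i, j}))))) \<and>
    delta scale \<pi> (n - 1) \<phi> = coboundary_reg scale \<pi> n \<phi>"
proof -
  interpret pre_lie_algebra scale Basis \<pi> by fact
  obtain m where n: "n = Suc m"
    using assms(2) by (cases n) auto
  have phi: "\<phi> \<in> C_space scale m"
    using assms(3) n by simp
  note hyps = vector_space_axioms linear_left linear_right phi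
  have "delta scale \<pi> m \<phi> = coboundary_reg scale \<pi> n \<phi>"
  proof
    fix xs
    show "delta scale \<pi> m \<phi> xs = coboundary_reg scale \<pi> n \<phi> xs"
    proof (cases "length xs = Suc (Suc m)")
      case True
      then show ?thesis
        unfolding delta_formula[OF hyps True]
        by (simp add: coboundary_reg_def coboundary_def commutator_def n del: sum.lessThan_Suc)
    next
      case False
      then show ?thesis
        by (simp add: coboundary_reg_def coboundary_def n delta_def C_bracket_def alternator_def)
    qed
  qed
  then show ?thesis
    using delta_in_C_space[OF hyps] delta_formula[OF hyps] by (simp add: n del: sum.lessThan_Suc)
qed

end
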